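(* Let $k_\mathcal{G}=n_\mathcal{G}\ge1$ and $k_\mathcal{H}=n_\mathcal{H}-4\ge1$, and write $n=n_\mathcal{H}$. For $g\in V(\mathcal{G})$ let $s_g=\sum_{i=0}^{4}\alpha_i\sigma_i(g)$, where $\alpha_0=\tfrac1{12}n^4(2\sqrt3+3\sqrt2+1)-\tfrac16 n^3(9\sqrt3+12\sqrt2+2)+\tfrac1{12}n^2(52\sqrt3+57\sqrt2-7)-\tfrac16 n(24\sqrt3+18\sqrt2-17)-2$, $\alpha_1=-\tfrac13 n^3(2\sqrt3+3\sqrt2+1)+\tfrac12 n^2(11\sqrt3+15\sqrt2+3)-\tfrac16 n(83\sqrt3+99\sqrt2+1)+10\sqrt3+10\sqrt2-3$, $\alpha_2=n^2(2\sqrt3+3\sqrt2+1)-n(13\sqrt3+18\sqrt2+4)+5(4\sqrt3+5\sqrt2)+2$, $\alpha_3=-2n(2\sqrt3+3\sqrt2+1)+15\sqrt3+21\sqrt2+5$, $\alpha_4=4\sqrt3+6\sqrt2+2$. Then these polynomials form a $4$-sum-of-squares certificate of $f_{\mathrm{viz}}$, i.e. $f_{\mathrm{viz}}\equiv\sum_{g\in V(\mathcal{G})}s_g^2\pmod{I_{\mathrm{viz}}}$; consequently $\gamma(G)\gamma(H)\le\gamma(G\Box H)$ for all graphs $G$ on $n_\mathcal{G}$ vertices with domination number $n_\mathcal{G}$ and $H$ on $n_\mathcal{H}$ vertices with domination number $n_\mathcal{H}-4$.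
   Context: $\mathbb{K}$ is a subfield of $\mathbb{R}$ containing $\sqrt2,\sqrt3$ (e.g. $\mathbb{K}=\mathbb{R}$). $V(\mathcal{G})$ is a set of $n_\mathcal{G}$ vertices with fixed subset $D_\mathcal{G}$ of size $k_\mathcal{G}$; $V(\mathcal{H})$ a disjoint set of $n_\mathcal{H}$ vertices with fixed subset $D_\mathcal{H}$ of size $k_\mathcal{H}$. Variables $e_{gg'}=e_{g'g}$ for 2-subsets of $V(\mathcal{G})$, $e_{hh'}$ for 2-subsets of $V(\mathcal{H})$, $x_{gh}$ for $g\in V(\mathcal{G}),h\in V(\mathcal{H})$; $P$ is the polynomial ring over $\mathbb{K}$ in these. $I_{\mathrm{viz}}\subseteq P$ is generated by: $e_{gg'}^2-e_{gg'}$; $\prod_{g'\in D_\mathcal{G}}(1-e_{gg'})$ for $g\in V(\mathcal{G})\setminus D_\mathcal{G}$; $\prod_{g'\in V(\mathcal{G})\setminus S}\sum_{g\in S}e_{gg'}$ for $S\subseteq V(\mathcal{G})$, $|S|=k_\mathcal{G}-1$; the same three families for $\mathcal{H}$; $x_{gh}^2-x_{gh}$; and $(1-x_{gh})\prod_{g'\ne g}(1-e_{gg'}x_{g'h})\prod_{h'\ne h}(1-e_{hh'}x_{gh'})$ for all $g,h$. $f_{\mathrm{viz}}=\sum_{g,h}x_{gh}-k_\mathcal{G}k_\mathcal{H}$. For $g\in V(\mathcal{G})$ and integer $i\ge0$, $\sigma_i(g)=\sum_{S\subseteq V(\mathcal{H}),|S|=i}\prod_{h\in S}x_{gh}$ ($\sigma_0(g)=1$).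 $\gamma(\cdot)$ is the domination number, $G\Box H$ the Cartesian product graph. An $\ell$-sum-of-squares certificate of $f$ modulo $I$ is a family of polynomials of degree $\le\ell$ whose sum of squares is congruent to $f$ modulo $I$. *)

theory Defs
  imports
    Complex_Main
    "HOL-Library.Poly_Mapping"
    "HOL-Algebra.Ideal"
    "HOL-Algebra.Subrings"
    "HOL-Algebra.Algebraic_Closure_Type"
    "Graph_Theory.Pair_Digraph"
begin

text \<open>
  Finite simple graphs are rendered by \<^locale>\<open>pair_graph\<close>: a finite vertex set
  \<^const>\<open>pverts\<close> with a symmetric irreflexive adjacency relation \<^const>\<open>parcs\<close>.
\<close>

definition dominating_set :: "'a pair_pre_digraph \<Rightarrow> 'a set \<Rightarrow> bool" where
  "dominating_set G D \<longleftrightarrow>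
     D \<subseteq> pverts G \<and> (\<forall>v \<in> pverts G - D. \<exists>u\<in>D. (u, v) \<in> parcs G)"

definition domination_number :: "'a pair_pre_digraph \<Rightarrow> nat" where
  "domination_number G = Min (card ` {D. dominating_set G D})"

definition cartesian_graph_product ::
    "'a pair_pre_digraph \<Rightarrow> 'b pair_pre_digraph \<Rightarrow> ('a \<times> 'b) pair_pre_digraph"
  where
  "cartesian_graph_product G H =
     \<lparr> pverts = pverts G \<times> pverts H,
       parcs = {((g, h), (g', h')) | g h g' h'.
                  (g = g' \<and> g \<in> pverts G \<and> (h, h') \<in> parcs H) \<or>
                  (h = h' \<and> h \<in> pverts H \<and> (g, g') \<in> parcs G)} \<rparr>"

text \<open>
  A polynomial is a finitely supported map from monomials to coefficients, and a monomial a
  finitely supported map from variables to exponents; the ring operations of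
  \<^type>\<open>poly_mapping\<close> are then those of the polynomial ring.
\<close>

type_synonym 'v mpolynomial = "('v \<Rightarrow>\<^sub>0 nat) \<Rightarrow>\<^sub>0 real"

definition Const :: "real \<Rightarrow> 'v mpolynomial" where
  "Const c = Poly_Mapping.single 0 c"

definition Var :: "'v \<Rightarrow> 'v mpolynomial" where
  "Var v = Poly_Mapping.single (Poly_Mapping.single v 1) 1"

definition total_degree :: "'v mpolynomial \<Rightarrow> nat" where
  "total_degree p =
     Max (insert 0 ((\<lambda>m. \<Sum>v\<in>Poly_Mapping.keys m. Poly_Mapping.lookup m v) ` Poly_Mapping.keys p))"

definition polynomial_ring :: "real set \<Rightarrow> 'v set \<Rightarrow> 'v mpolynomial ring" where
  "polynomial_ring K Vs = ring_of_type_algebra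
     \<lparr> carrier := {p. (\<forall>m. Poly_Mapping.lookup p m \<in> K) \<and>
                      (\<forall>m\<in>Poly_Mapping.keys p. Poly_Mapping.keys m \<subseteq> Vs)} \<rparr>"

definition sos_certificate ::
    "'v mpolynomial ring \<Rightarrow> 'v mpolynomial set \<Rightarrow> nat \<Rightarrow>
     'i set \<Rightarrow> ('i \<Rightarrow> 'v mpolynomial) \<Rightarrow> 'v mpolynomial \<Rightarrow> bool" where
  "sos_certificate P I l A s f \<longleftrightarrow>
     finite A \<and>
     (\<forall>a\<in>A. s a \<in> carrier P \<and> total_degree (s a) \<le> l) \<and>
     f - (\<Sum>a\<in>A. (s a)\<^sup>2) \<in> I"

text \<open>
  The edge variables are indexed by two-element vertex sets, so that the variables for
  \<open>(g, g')\<close> and \<open>(g', g)\<close> coincide.  The two vertex sets are disjoint because they are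
  drawn from separate types (or separate copies of one type).
\<close>

datatype ('g, 'h) viz_var = EG "'g set" | EH "'h set" | XV 'g 'h

definition viz_vars :: "'g set \<Rightarrow> 'h set \<Rightarrow> ('g, 'h) viz_var set" where
  "viz_vars VG VH =
     {EG {g, g'} | g g'. g \<in> VG \<and> g' \<in> VG \<and> g \<noteq> g'} \<union>
     {EH {h, h'} | h h'. h \<in> VH \<and> h' \<in> VH \<and> h \<noteq> h'} \<union>
     {XV g h | g h. g \<in> VG \<and> h \<in> VH}"

abbreviation eG :: "'g \<Rightarrow> 'g \<Rightarrow> ('g, 'h) viz_var mpolynomial" where
  "eG g g' \<equiv> Var (EG {g, g'})"

abbreviation eH :: "'h \<Rightarrow> 'h \<Rightarrow> ('g, 'h) viz_var mpolynomial" where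
  "eH h h' \<equiv> Var (EH {h, h'})"

abbreviation xv :: "'g \<Rightarrow> 'h \<Rightarrow> ('g, 'h) viz_var mpolynomial" where
  "xv g h \<equiv> Var (XV g h)"

definition graph_generators ::
    "'a set \<Rightarrow> 'a set \<Rightarrow> ('a \<Rightarrow> 'a \<Rightarrow> 'v mpolynomial) \<Rightarrow> 'v mpolynomial set" where
  "graph_generators V D e =
     {(e u v)\<^sup>2 - e u v | u v. u \<in> V \<and> v \<in> V \<and> u \<noteq> v} \<union>
     {\<Prod>v\<in>D. (1 - e u v) | u. u \<in> V - D} \<union>
     {\<Prod>v\<in>V - S. \<Sum>u\<in>S. e u v | S. S \<subseteq> V \<and> card S + 1 = card D}"

definition product_generators ::
    "'g set \<Rightarrow> 'h set \<Rightarrow> ('g, 'h) viz_var mpolynomial set" where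
  "product_generators VG VH =
     {(xv g h)\<^sup>2 - xv g h | g h. g \<in> VG \<and> h \<in> VH} \<union>
     {(1 - xv g h) * (\<Prod>g'\<in>VG - {g}. (1 - eG g g' * xv g' h))
                   * (\<Prod>h'\<in>VH - {h}. (1 - eH h h' * xv g h')) | g h. g \<in> VG \<and> h \<in> VH}"

abbreviation viz_ring ::
    "real set \<Rightarrow> 'g set \<Rightarrow> 'h set \<Rightarrow> ('g, 'h) viz_var mpolynomial ring" where
  "viz_ring K VG VH \<equiv> polynomial_ring K (viz_vars VG VH)"

definition viz_ideal ::
    "real set \<Rightarrow> 'g set \<Rightarrow> 'g set \<Rightarrow> 'h set \<Rightarrow> 'h set \<Rightarrow> ('g, 'h) viz_var mpolynomial set" where
  "viz_ideal K VG DG VH DH =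
     Idl\<^bsub>viz_ring K VG VH\<^esub>
       (graph_generators VG DG eG \<union> graph_generators VH DH eH \<union> product_generators VG VH)"

definition viz_poly ::
    "'g set \<Rightarrow> 'g set \<Rightarrow> 'h set \<Rightarrow> 'h set \<Rightarrow> ('g, 'h) viz_var mpolynomial" where
  "viz_poly VG DG VH DH =
     (\<Sum>g\<in>VG. \<Sum>h\<in>VH. xv g h) - Const (real (card DG) * real (card DH))"

definition sigma_poly :: "'h set \<Rightarrow> nat \<Rightarrow> 'g \<Rightarrow> ('g, 'h) viz_var mpolynomial" where
  "sigma_poly VH i g = (\<Sum>S | S \<subseteq> VH \<and> card S = i. \<Prod>h\<in>S. xv g h)"

definition alpha :: "real \<Rightarrow> nat \<Rightarrow> real" where
  "alpha n i =
    [ 1/12 * n^4 * (2 * sqrt 3 + 3 * sqrt 2 + 1)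
        - 1/6 * n^3 * (9 * sqrt 3 + 12 * sqrt 2 + 2)
        + 1/12 * n^2 * (52 * sqrt 3 + 57 * sqrt 2 - 7)
        - 1/6 * n * (24 * sqrt 3 + 18 * sqrt 2 - 17) - 2,
      - 1/3 * n^3 * (2 * sqrt 3 + 3 * sqrt 2 + 1)
        + 1/2 * n^2 * (11 * sqrt 3 + 15 * sqrt 2 + 3)
        - 1/6 * n * (83 * sqrt 3 + 99 * sqrt 2 + 1)
        + 10 * sqrt 3 + 10 * sqrt 2 - 3,
      n^2 * (2 * sqrt 3 + 3 * sqrt 2 + 1)
        - n * (13 * sqrt 3 + 18 * sqrt 2 + 4)
        + 5 * (4 * sqrt 3 + 5 * sqrt 2) + 2,
      - 2 * n * (2 * sqrt 3 + 3 * sqrt 2 + 1) + 15 * sqrt 3 + 21 * sqrt 2 + 5,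
      4 * sqrt 3 + 6 * sqrt 2 + 2 ] ! i"

definition s_poly :: "'h set \<Rightarrow> 'g \<Rightarrow> ('g, 'h) viz_var mpolynomial" where
  "s_poly VH g = (\<Sum>i\<le>4. Const (alpha (real (card VH)) i) * sigma_poly VH i g)"

end

theory Submission
  imports Defs
begin

text \<open>
  Since the ideal contains \<open>v\<^sup>2 - v\<close> for every variable \<open>v\<close>, membership of a polynomial may be
  tested at the common zeros of the generators with coordinates in \<open>{0, 1}\<close>.  At such a
  zero the graph on \<open>VG\<close> has no edges, because no \<open>nG - 1\<close> vertices dominate it.  Hence every
  fibre \<open>F g = {h. x_gh = 1}\<close> dominates the graph on \<open>VH\<close> and has between \<open>nH - 4\<close> and \<open>nH\<close>
  elements, while \<open>s_g\<close> only depends on \<open>card (F g)\<close>: for \<open>card (F g) = nH - 4 + j\<close> it takes the values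
  \<open>0\<close>, \<open>-1\<close>, \<open>sqrt 2\<close>, \<open>- sqrt 3\<close>, \<open>-2\<close> for \<open>j = 0, \<dots>, 4\<close>, with squares \<open>j\<close>.
  The inequality for domination numbers is obtained from the same fibres directly.
\<close>

section \<open>Domination numbers\<close>

lemma finite_dominating_sets:
  "finite (pverts G) \<Longrightarrow> finite {D. dominating_set G D}"
  by (rule finite_subset[of _ "Pow (pverts G)"]) (auto simp: dominating_set_def)

lemma domination_number_le:
  "\<lbrakk>finite (pverts G); dominating_set G D\<rbrakk> \<Longrightarrow> domination_number G \<le> card D"
  unfolding domination_number_def by (intro Min_le) (auto intro: finite_dominating_sets)

lemma domination_number_attained:
  assumes "finite (pverts G)"
  obtains D where "dominating_set G D" and "card D = domination_number G"
proof -
  have "dominating_set G (pverts G)"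
    by (auto simp: dominating_set_def)
  then have "domination_number G \<in> card ` {D. dominating_set G D}"
    unfolding domination_number_def
    by (intro Min_in) (auto intro: finite_dominating_sets assms)
  then show thesis
    using that by auto
qed

text \<open>An edge \<open>(u, v)\<close> would let \<open>u\<close> dominate \<open>v\<close>, so
  deleting \<open>v\<close> from the vertex set would leave a dominating set that is too
  small.\<close>

lemma edgeless_if_domination_number_eq_card:
  assumes "pair_graph G" and "domination_number G = card (pverts G)"
  shows "parcs G = {}"
proof (rule ccontr)
  interpret pair_graph G by fact
  assume "parcs G \<noteq> {}"
  then obtain u v where uv: "(u, v) \<in> parcs G"
    by auto
  then have "u \<in> pverts G" "v \<in> pverts G" "u \<noteq> v"
    using in_arcsD1 in_arcsD2 pair_no_loops by fastforce+
  then have "dominating_set G (pverts G - {v})"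
    using uv by (auto simp: dominating_set_def)
  then have "domination_number G \<le> card (pverts G - {v})"
    by (rule domination_number_le[OF pair_finite_verts])
  also have "\<dots> < card (pverts G)"
    using \<open>v \<in> pverts G\<close> by (intro psubset_card_mono pair_finite_verts) auto
  finally show False
    using assms(2) by simp
qed

text \<open>Without edges in \<open>G\<close>, a vertex \<open>(g, h)\<close> can only be dominated
  from its own fibre. Hence each fibre of a minimum dominating set dominates \<open>H\<close>, and
  the fibres partition that set.\<close>

lemma vizing_edgeless:
  assumes "finite (pverts G)" and "finite (pverts H)" and "parcs G = {}"
  shows "card (pverts G) * domination_number H
           \<le> domination_number (cartesian_graph_product G H)"
proof -
  let ?P = "cartesian_graph_product G H"
  have fin: "finite (pverts ?P)"
    using assms by (simp add: cartesian_graph_product_def)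
  obtain D where D: "dominating_set ?P D" "card D = domination_number ?P"
    by (rule domination_number_attained[OF fin])
  define F where "F g = {h. (g, h) \<in> D}" for g
  have sub: "D \<subseteq> pverts G \<times> pverts H"
    using D(1) by (auto simp: dominating_set_def cartesian_graph_product_def)
  have D_eq: "D = (SIGMA g:pverts G. F g)"
    using sub by (auto simp: F_def)
  have finF: "finite (F g)" for g
    by (rule finite_subset[OF _ assms(2)]) (use sub in \<open>auto simp: F_def\<close>)
  have "dominating_set H (F g)" if g: "g \<in> pverts G" for g
    unfolding dominating_set_def
  proof safe
    fix h assume "h \<in> F g" then show "h \<in> pverts H"
      using sub by (auto simp: F_def)
  next
    fix h assume "h \<in> pverts H" "h \<notin> F g"
    then have "(g, h) \<in> pverts ?P - D"
      using g by (auto simp: F_def cartesian_graph_product_def)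
    then obtain u where "u \<in> D" "(u, (g, h)) \<in> parcs ?P"
      using D(1) unfolding dominating_set_def by blast
    then show "\<exists>h'\<in>F g. (h', h) \<in> parcs H"
      using assms(3) by (auto simp: F_def cartesian_graph_product_def)
  qed
  then have "card (pverts G) * domination_number H \<le> (\<Sum>g\<in>pverts G. card (F g))"
    using domination_number_le[OF assms(2)] sum_bounded_below[of "pverts G" "domination_number H" "\<lambda>g. card (F g)"]
    by simp
  also have "\<dots> = card D"
    unfolding D_eq using finF assms(1) by simp
  finally show ?thesis
    using D(2) by simp
qed

section \<open>The coefficients of the certificate\<close>

text \<open>Here \<open>t\<close> stands for the number of ones among the \<open>x_gh\<close> with
  fixed \<open>g\<close>, where \<open>sigma_i\<close> takes the value \<open>t choose i\<close>.
  The sum is the polynomial in \<open>t\<close> of degree at most 4 that interpolates one square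
  root of \<open>j\<close> at each \<open>t = N - 4 + j\<close>; \<open>alpha\<close> lists its
  coefficients in the binomial basis.\<close>

lemma alpha_certificate_identity:
  fixes N t :: nat
  assumes "N \<ge> 4" and "N - 4 \<le> t" and "t \<le> N"
  shows "(\<Sum>i\<le>4. alpha (real N) i * real (t choose i))\<^sup>2 = real t - real (N - 4)"
proof -
  define j where "j = t - (N - 4)"
  have j: "j \<in> {0,1,2,3,4}" and rt: "real t = real N - 4 + real j"
    using assms by (auto simp: j_def)
  define x where "x = real N"
  have c0: "real (t choose 0) = 1" by simp
  \<comment> \<open>These formulas also hold for \<open>t\<close> below the lower index, where both
    sides vanish.\<close>
  have c: "real (t choose 1) = real t" 
    "real (t choose 2) = real t * (real t - 1) / 2"
    "real (t choose 3) = real t * (real t - 1) * (real t - 2) / 6"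
    "real (t choose 4) = real t * (real t - 1) * (real t - 2) * (real t - 3) / 24"
    by (simp_all add: binomial_gbinomial gbinomial_prod_rev numeral_eq_Suc)
  have s: "(\<Sum>i\<le>4. alpha x i * real (t choose i)) = 
     alpha x 0 * real (t choose 0) + alpha x 1 * real (t choose 1) + alpha x 2 * real (t choose 2)
     + alpha x 3 * real (t choose 3) + alpha x 4 * real (t choose 4)"
    by (simp add: numeral_eq_Suc)
  have "(\<Sum>i\<le>4. alpha x i * real (t choose i)) = [0, -1, sqrt 2, - sqrt 3, -2] ! j"
    \<comment> \<open>For each fixed \<open>j\<close> this is a polynomial identity in
      \<open>x\<close>, linear in \<open>sqrt 2\<close> and \<open>sqrt 3\<close>, so expanding both
      sides settles it.\<close>
    unfolding s c0 c
    unfolding alpha_def rt x_def[symmetric]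
    using j
    by (elim insertE emptyE; simp;
        simp add: field_simps power2_eq_square power3_eq_cube power4_eq_xxxx)
  moreover have "([0, -1, sqrt 2, - sqrt 3, -2] ! j)\<^sup>2 = real j"
    using j by auto
  moreover have "real j = real t - real (N - 4)"
    using rt assms(1) by simp
  ultimately show ?thesis
    by (simp add: x_def)
qed

section \<open>Arithmetic in a subfield of the reals\<close>

lemma real_subfield_closed:
  assumes "subfield K (ring_of_type_algebra :: real ring)"
  shows "1 \<in> K"
    and "x \<in> K \<Longrightarrow> y \<in> K \<Longrightarrow> x + y \<in> K"
    and "x \<in> K \<Longrightarrow> y \<in> K \<Longrightarrow> x - y \<in> K"
    and "x \<in> K \<Longrightarrow> - x \<in> K"
    and "x \<in> K \<Longrightarrow> y \<in> K \<Longrightarrow> x * y \<in> K"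
    and "x \<in> K \<Longrightarrow> inverse x \<in> K"
proof -
  interpret R: ring "ring_of_type_algebra :: real ring"
    by (rule ring_from_type_algebra)
  interpret subfield K "ring_of_type_algebra :: real ring"
    by fact
  note sub = subringE[OF subring_axioms]
  \<comment> \<open>The additive inverse of the algebraic structure is identified with real negation
    by uniqueness of inverses.\<close>
  have neg: "- x \<in> K" if "x \<in> K" for x
  proof -
    have "\<ominus>\<^bsub>ring_of_type_algebra\<^esub> x = - x"
      by (rule R.minus_equality) (simp_all add: ring_of_type_algebra_def)
    then show ?thesis using sub(5)[OF that] by simp
  qed
  have add: "x + y \<in> K" if "x \<in> K" "y \<in> K" for x y
    using sub(7)[OF that] by (simp add: ring_of_type_algebra_def)
  show "1 \<in> K"
    using sub(3) by (simp add: ring_of_type_algebra_def)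
  show "x \<in> K \<Longrightarrow> - x \<in> K" "x \<in> K \<Longrightarrow> y \<in> K \<Longrightarrow> x + y \<in> K"
    by (fact neg, fact add)
  show "x \<in> K \<Longrightarrow> y \<in> K \<Longrightarrow> x - y \<in> K"
    using add[of x "- y"] neg by simp
  show "x \<in> K \<Longrightarrow> y \<in> K \<Longrightarrow> x * y \<in> K"
    using sub(6)[of x y] by (simp add: ring_of_type_algebra_def)
  have "inverse x \<in> K" if x: "x \<in> K" "x \<noteq> 0"
  proof -
    have "x \<in> Units (ring_of_type_algebra\<lparr>carrier := K\<rparr>)"
      unfolding subfield_Units using x by (simp add: ring_of_type_algebra_def)
    then obtain y where "y \<in> K" "x * y = 1"
      by (auto simp: Units_def ring_of_type_algebra_def)
    then show ?thesis
      by (metis inverse_unique)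
  qed
  \<comment> \<open>The remaining case is \<open>x = 0\<close>, where
    \<open>inverse 0 = 0\<close>.\<close>
  then show "x \<in> K \<Longrightarrow> inverse x \<in> K"
    by (cases "x = 0") auto
qed

lemma real_subfield_numerals:
  assumes "subfield K (ring_of_type_algebra :: real ring)"
  shows "real n \<in> K" and "numeral k \<in> K" and "x \<in> K \<Longrightarrow> x ^ n \<in> K" and "0 \<in> K"
    and "x \<in> K \<Longrightarrow> y \<in> K \<Longrightarrow> x / y \<in> K"
proof -
  note cl = real_subfield_closed[OF assms]
  show zero: "0 \<in> K"
    using cl(3)[of 1 1] cl(1) by simp
  have of_nat: "real n \<in> K" for n
    by (induction n) (auto intro: cl zero)
  then show "real n \<in> K" .
  show "numeral k \<in> K"
    using of_nat[of "numeral k"] by simp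
  show "x \<in> K \<Longrightarrow> x ^ n \<in> K"
    by (induction n) (auto intro: cl)
  show "x \<in> K \<Longrightarrow> y \<in> K \<Longrightarrow> x / y \<in> K"
    by (auto simp: divide_inverse intro: cl)
qed

lemma alpha_in_subfield:
  assumes "subfield K (ring_of_type_algebra :: real ring)"
    and "sqrt 2 \<in> K" and "sqrt 3 \<in> K" and "i \<le> 4"
  shows "alpha (real n) i \<in> K"
proof -
  have i: "i \<in> {0, 1, 2, 3, 4}"
    using assms(4) by auto
  note cl = real_subfield_closed[OF assms(1)] real_subfield_numerals[OF assms(1)]
  show ?thesis
    using i unfolding alpha_def by (elim insertE emptyE; simp; intro cl assms)
qed

section \<open>Polynomials over a subfield of the reals\<close>

lemma Const_add: "Const (c + d) = Const c + Const d"
  and Const_diff: "Const (c - d) = Const c - Const d"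
  and Const_mult: "Const (c * d) = Const c * Const d"
  by (simp_all add: Const_def single_add single_diff mult_single)

lemma prod_Var:
  "finite A \<Longrightarrow> (\<Prod>h\<in>A. Var (f h)) = Poly_Mapping.single (\<Sum>h\<in>A. Poly_Mapping.single (f h) 1) 1"
  by (induction A rule: finite_induct) (simp_all add: Var_def mult_single)

lemma polynomial_ring_simps [simp]:
  "monoid.mult (polynomial_ring K Vs) p q = p * q"
  "ring.add (polynomial_ring K Vs) p q = p + q"
  "monoid.one (polynomial_ring K Vs) = 1"
  "ring.zero (polynomial_ring K Vs) = 0"
  by (simp_all add: polynomial_ring_def ring_of_type_algebra_def)

lemma in_polynomial_ring:
  "p \<in> carrier (polynomial_ring K Vs) \<longleftrightarrow>
     (\<forall>m. Poly_Mapping.lookup p m \<in> K) \<and> (\<forall>m\<in>Poly_Mapping.keys p. Poly_Mapping.keys m \<subseteq> Vs)"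
  by (simp add: polynomial_ring_def)

lemma single_in_polynomial_ring:
  "\<lbrakk>0 \<in> K; c \<in> K; Poly_Mapping.keys m \<subseteq> Vs\<rbrakk>
     \<Longrightarrow> Poly_Mapping.single m c \<in> carrier (polynomial_ring K Vs)"
  by (simp add: in_polynomial_ring lookup_single when_def)

lemma Const_in_polynomial_ring:
  "\<lbrakk>0 \<in> K; c \<in> K\<rbrakk> \<Longrightarrow> Const c \<in> carrier (polynomial_ring K Vs)"
  by (simp add: Const_def single_in_polynomial_ring)

lemma Var_in_polynomial_ring:
  "\<lbrakk>0 \<in> K; 1 \<in> K; v \<in> Vs\<rbrakk> \<Longrightarrow> Var v \<in> carrier (polynomial_ring K Vs)"
  by (simp add: Var_def single_in_polynomial_ring)

lemma sum_in_polynomial_ring: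
  assumes "subfield K (ring_of_type_algebra :: real ring)"
    and "\<And>i. i \<in> A \<Longrightarrow> p i \<in> carrier (polynomial_ring K Vs)"
  shows "(\<Sum>i\<in>A. p i) \<in> carrier (polynomial_ring K Vs)"
  using assms(2)
proof (induction A rule: infinite_finite_induct)
  case (insert i A)
  note cl = real_subfield_closed[OF assms(1)]
  have "p i \<in> carrier (polynomial_ring K Vs)" "(\<Sum>i\<in>A. p i) \<in> carrier (polynomial_ring K Vs)"
    using insert by auto
  then show ?case
    using insert.hyps keys_add[of "p i" "\<Sum>i\<in>A. p i"]
    unfolding in_polynomial_ring by (simp add: lookup_add cl) blast
qed (use real_subfield_numerals[OF assms(1)] in \<open>simp_all add: in_polynomial_ring\<close>)

section \<open>Degree bounds and membership of the certificate polynomials\<close>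

lemma total_degree_le_iff:
  "total_degree p \<le> d \<longleftrightarrow>
     (\<forall>m\<in>Poly_Mapping.keys p. (\<Sum>v\<in>Poly_Mapping.keys m. Poly_Mapping.lookup m v) \<le> d)"
  by (simp add: total_degree_def)

lemma total_degree_sum_le:
  "(\<And>i. i \<in> A \<Longrightarrow> total_degree (p i) \<le> d) \<Longrightarrow> total_degree (\<Sum>i\<in>A. p i) \<le> d"
  using keys_sum[of p A] unfolding total_degree_le_iff by blast

lemma keys_sum_single_subset:
  "Poly_Mapping.keys (\<Sum>h\<in>S. Poly_Mapping.single (f h) (1::nat)) \<subseteq> f ` S"
  using keys_sum[of "\<lambda>h. Poly_Mapping.single (f h) (1::nat)" S] by auto

text \<open>The exponents count each \<open>h\<close> in \<open>S\<close> once, at the variable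
  \<open>f h\<close>. Only a bound is claimed, since \<open>c\<close> may be 0.\<close>

lemma total_degree_monomial_le:
  assumes "finite S"
  shows "total_degree (Const c * (\<Prod>h\<in>S. Var (f h))) \<le> card S"
proof -
  define m where "m = (\<Sum>h\<in>S. Poly_Mapping.single (f h) (1::nat))"
  have "(\<Sum>v\<in>Poly_Mapping.keys m. Poly_Mapping.lookup m v) \<le> (\<Sum>v\<in>f ` S. Poly_Mapping.lookup m v)"
    using assms keys_sum_single_subset[of f S] unfolding m_def by (intro sum_mono2) auto
  also have "\<dots> = (\<Sum>v\<in>f ` S. \<Sum>h\<in>S. if f h = v then 1 else 0)"
    by (simp add: m_def lookup_sum lookup_single when_def cong: if_cong)
  also have "\<dots> = card S"
    using assms(1) by (subst sum.swap) simp
  finally show ?thesis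
    by (simp add: total_degree_le_iff prod_Var assms(1) Const_def mult_single m_def)
qed

text \<open>Multiplying out gives a sum of scaled monomials, so that degree and membership can be
  checked term by term.\<close>

lemma s_poly_eq_sum:
  "s_poly VH g = (\<Sum>i\<le>4. \<Sum>S | S \<subseteq> VH \<and> card S = i.
     Const (alpha (real (card VH)) i) * (\<Prod>h\<in>S. xv g h))"
  by (simp add: s_poly_def sigma_poly_def sum_distrib_left)

lemma total_degree_s_poly:
  assumes "finite VH"
  shows "total_degree (s_poly VH g) \<le> 4"
  unfolding s_poly_eq_sum
proof (intro total_degree_sum_le)
  fix i S assume "i \<in> {..4::nat}" "S \<in> {S. S \<subseteq> VH \<and> card S = i}"
  then show "total_degree (Const (alpha (real (card VH)) i) * (\<Prod>h\<in>S. xv g h)) \<le> 4"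
    using total_degree_monomial_le[of S "alpha (real (card VH)) i" "XV g"] finite_subset[OF _ assms]
    by (auto intro: order_trans)
qed

lemma s_poly_in_viz_ring:
  assumes "subfield K (ring_of_type_algebra :: real ring)"
    and "sqrt 2 \<in> K" and "sqrt 3 \<in> K" and "finite VH" and "g \<in> VG"
  shows "s_poly VH g \<in> carrier (viz_ring K VG VH)"
  unfolding s_poly_eq_sum
proof (intro sum_in_polynomial_ring[OF assms(1)])
  fix i S assume i: "i \<in> {..4::nat}" and S: "S \<in> {S. S \<subseteq> VH \<and> card S = i}"
  then have "finite S"
    using assms(4) finite_subset by auto
  moreover have "XV g ` S \<subseteq> viz_vars VG VH"
    using S assms(5) by (auto simp: viz_vars_def)
  ultimately show "Const (alpha (real (card VH)) i) * (\<Prod>h\<in>S. xv g h) \<in> carrier (viz_ring K VG VH)"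
    using keys_sum_single_subset[of "XV g" S] i
    by (auto simp: prod_Var Const_def mult_single
        intro!: single_in_polynomial_ring alpha_in_subfield[OF assms(1-3)]
          real_subfield_numerals[OF assms(1)])
qed

section \<open>Ideals containing the Boolean relations\<close>

text \<open>The ideal is arbitrary because a generated ideal is the intersection of all ideals
  containing the generators: the argument is run in each of these.\<close>

locale boolean_ideal =
  fixes K :: "real set" and Vs :: "'v set" and I :: "'v mpolynomial set"
  assumes subfield_K: "subfield K (ring_of_type_algebra :: real ring)"
    and finite_Vs: "finite Vs"
    and ideal_I: "ideal I (polynomial_ring K Vs)"
    and boolean: "v \<in> Vs \<Longrightarrow> (Var v)\<^sup>2 - Var v \<in> I"
begin

abbreviation P :: "'v mpolynomial ring" where "P \<equiv> polynomial_ring K Vs"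

lemmas K_closed = real_subfield_closed[OF subfield_K] real_subfield_numerals[OF subfield_K]

lemma Const_closed: "c \<in> K \<Longrightarrow> Const c \<in> carrier P"
  by (intro Const_in_polynomial_ring K_closed)

lemma Var_closed: "v \<in> Vs \<Longrightarrow> Var v \<in> carrier P"
  by (intro Var_in_polynomial_ring K_closed)

lemma add_closed: "p \<in> carrier P \<Longrightarrow> q \<in> carrier P \<Longrightarrow> p + q \<in> carrier P"
  and mult_closed: "p \<in> carrier P \<Longrightarrow> q \<in> carrier P \<Longrightarrow> p * q \<in> carrier P"
proof -
  interpret ideal I P by (rule ideal_I)
  show "p \<in> carrier P \<Longrightarrow> q \<in> carrier P \<Longrightarrow> p + q \<in> carrier P"
    using add.m_closed[of p q] by simp
  show "p \<in> carrier P \<Longrightarrow> q \<in> carrier P \<Longrightarrow> p * q \<in> carrier P"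
    using m_closed[of p q] by simp
qed

text \<open>This reduces closure under negation and subtraction to closure under multiplication by a
  constant of \<open>K\<close>.\<close>

lemma Const_minus_one: "Const (- 1) * p = - p"
  by (simp add: Const_def single_uminus)

lemma diff_closed: "p \<in> carrier P \<Longrightarrow> q \<in> carrier P \<Longrightarrow> p - q \<in> carrier P"
  using add_closed[OF _ mult_closed[OF Const_closed[of "- 1"]], of p q] K_closed
  by (simp add: Const_minus_one)

lemma one_closed: "1 \<in> carrier P"
  using Const_closed[of 1] K_closed by (simp add: Const_def)

lemma prod_closed: "(\<And>i. i \<in> A \<Longrightarrow> p i \<in> carrier P) \<Longrightarrow> (\<Prod>i\<in>A. p i) \<in> carrier P"
  by (induction A rule: infinite_finite_induct) (auto intro: one_closed mult_closed)

lemma I_add: "p \<in> I \<Longrightarrow> q \<in> I \<Longrightarrow> p + q \<in> I"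
  and I_mult: "p \<in> I \<Longrightarrow> q \<in> carrier P \<Longrightarrow> p * q \<in> I"
  and I_zero: "0 \<in> I"
proof -
  interpret ideal I P by (rule ideal_I)
  show "p \<in> I \<Longrightarrow> q \<in> I \<Longrightarrow> p + q \<in> I"
    using additive_subgroup.a_closed[OF additive_subgroup_axioms, of p q] by simp
  show "p \<in> I \<Longrightarrow> q \<in> carrier P \<Longrightarrow> p * q \<in> I"
    using I_r_closed[of p q] by simp
  show "0 \<in> I"
    using additive_subgroup.zero_closed[OF additive_subgroup_axioms] by simp
qed

lemma I_uminus: "p \<in> I \<Longrightarrow> - p \<in> I"
  using I_mult[of p "Const (- 1)"] Const_closed[of "- 1"] K_closed
  by (simp add: mult.commute[of p] Const_minus_one)

lemma I_diff: "p \<in> I \<Longrightarrow> q \<in> I \<Longrightarrow> p - q \<in> I"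
  using I_add[of p "- q"] I_uminus by simp

lemma I_sum: "(\<And>i. i \<in> A \<Longrightarrow> p i \<in> I) \<Longrightarrow> (\<Sum>i\<in>A. p i) \<in> I"
  by (induction A rule: infinite_finite_induct) (auto intro: I_zero I_add)

text \<open>A set \<open>T\<close> of variables encodes the 0/1 point with support \<open>T\<close>;
  among the 0/1 points this polynomial is 1 there and 0 elsewhere.\<close>

definition point_indicator :: "'v set \<Rightarrow> 'v mpolynomial" where
  "point_indicator T = (\<Prod>v\<in>T. Var v) * (\<Prod>v\<in>Vs - T. 1 - Var v)"

text \<open>Evaluation at a point, expressed as a congruence modulo \<open>I\<close>. The conditions
  on \<open>p\<close> and \<open>c\<close> keep the cofactors in \<open>P\<close> when products are
  formed. The value is not unique if \<open>point_indicator T\<close> itself lies in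
  \<open>I\<close>.\<close>

definition takes_value :: "'v set \<Rightarrow> 'v mpolynomial \<Rightarrow> real \<Rightarrow> bool" where
  "takes_value T p c \<longleftrightarrow>
     p \<in> carrier P \<and> c \<in> K \<and> (p - Const c) * point_indicator T \<in> I"

lemma takes_value_Const: "c \<in> K \<Longrightarrow> takes_value T (Const c) c"
  by (simp add: takes_value_def Const_closed I_zero)

lemma takes_value_1: "takes_value T 1 1"
  using takes_value_Const[of 1] K_closed by (simp add: Const_def)

lemma takes_value_0: "takes_value T 0 0"
  using takes_value_Const[of 0] K_closed by (simp add: Const_def)

lemma takes_value_add:
  assumes "takes_value T p c" and "takes_value T q d"
  shows "takes_value T (p + q) (c + d)"
proof -
  have "(p + q - Const (c + d)) * point_indicator T =
        (p - Const c) * point_indicator T + (q - Const d) * point_indicator T"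
    by (simp add: Const_add algebra_simps)
  then show ?thesis
    using assms by (auto simp: takes_value_def intro: add_closed K_closed I_add)
qed

lemma takes_value_diff:
  assumes "takes_value T p c" and "takes_value T q d"
  shows "takes_value T (p - q) (c - d)"
proof -
  have "(p - q - Const (c - d)) * point_indicator T =
        (p - Const c) * point_indicator T - (q - Const d) * point_indicator T"
    by (simp add: Const_diff algebra_simps)
  then show ?thesis
    using assms by (auto simp: takes_value_def intro: diff_closed K_closed I_diff)
qed

lemma takes_value_mult:
  assumes "takes_value T p c" and "takes_value T q d"
  shows "takes_value T (p * q) (c * d)"
proof -
  have "(p * q - Const (c * d)) * point_indicator T =
        (p - Const c) * point_indicator T * q + (q - Const d) * point_indicator T * Const c"
    by (simp add: Const_mult algebra_simps)
  then show ?thesis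
    using assms
    by (auto simp: takes_value_def intro: mult_closed K_closed I_add I_mult Const_closed)
qed

lemma takes_value_power: "takes_value T p c \<Longrightarrow> takes_value T (p ^ n) (c ^ n)"
  by (induction n) (auto intro: takes_value_1 takes_value_mult)

lemma takes_value_sum:
  "(\<And>i. i \<in> A \<Longrightarrow> takes_value T (p i) (c i)) \<Longrightarrow> takes_value T (\<Sum>i\<in>A. p i) (\<Sum>i\<in>A. c i)"
  by (induction A rule: infinite_finite_induct) (auto intro: takes_value_0 takes_value_add)

lemma takes_value_prod:
  "(\<And>i. i \<in> A \<Longrightarrow> takes_value T (p i) (c i)) \<Longrightarrow> takes_value T (\<Prod>i\<in>A. p i) (\<Prod>i\<in>A. c i)"
  by (induction A rule: infinite_finite_induct) (auto intro: takes_value_1 takes_value_mult)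

text \<open>The indicator has the factor \<open>Var v\<close> or \<open>1 - Var v\<close>;
  multiplied by \<open>Var v - 1\<close> or \<open>Var v\<close> respectively, it yields the Boolean
  relation up to sign.\<close>

lemma takes_value_Var:
  assumes "v \<in> Vs" and "T \<subseteq> Vs"
  shows "takes_value T (Var v) (of_bool (v \<in> T))"
proof (cases "v \<in> T")
  case True
  let ?r = "(\<Prod>v\<in>T - {v}. Var v) * (\<Prod>v\<in>Vs - T. 1 - Var v)"
  have "(\<Prod>v\<in>T. Var v) = Var v * (\<Prod>v\<in>T - {v}. Var v :: 'v mpolynomial)"
    using True finite_subset[OF assms(2) finite_Vs] by (simp add: prod.remove)
  then have "(Var v - Const 1) * point_indicator T = ((Var v)\<^sup>2 - Var v) * ?r"
    by (simp only: point_indicator_def) (simp add: Const_def power2_eq_square algebra_simps)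
  moreover have "?r \<in> carrier P"
    using assms by (intro mult_closed prod_closed diff_closed one_closed Var_closed) auto
  ultimately show ?thesis
    using True assms boolean K_closed by (auto simp: takes_value_def intro: Var_closed I_mult)
next
  case False
  let ?r = "(\<Prod>v\<in>T. Var v) * (\<Prod>v\<in>Vs - T - {v}. 1 - Var v)"
  have "(\<Prod>v\<in>Vs - T. 1 - Var v) = (1 - Var v) * (\<Prod>v\<in>Vs - T - {v}. 1 - Var v :: 'v mpolynomial)"
    using False finite_Vs assms by (simp add: prod.remove)
  then have "(Var v - Const 0) * point_indicator T = - (((Var v)\<^sup>2 - Var v) * ?r)"
    by (simp only: point_indicator_def) (simp add: Const_def power2_eq_square algebra_simps)
  moreover have "?r \<in> carrier P"
    using assms by (intro mult_closed prod_closed diff_closed one_closed Var_closed) auto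
  ultimately show ?thesis
    using False assms boolean K_closed
    by (auto simp: takes_value_def intro!: Var_closed I_uminus intro: I_mult)
qed

lemma point_indicator_closed: "T \<subseteq> Vs \<Longrightarrow> point_indicator T \<in> carrier P"
  unfolding point_indicator_def
  by (intro mult_closed prod_closed diff_closed one_closed Var_closed) auto

text \<open>Modulo \<open>I\<close>, the product of \<open>p\<close> with the indicator is 0 and
  also \<open>c\<close> times the indicator, and \<open>c\<close> is invertible in \<open>K\<close>.
  Conversely, a point whose indicator is outside \<open>I\<close> behaves like a common zero of
  \<open>I\<close>.\<close>

lemma point_indicator_in_ideal:
  assumes "T \<subseteq> Vs" and "p \<in> I" and "takes_value T p c" and "c \<noteq> 0"
  shows "point_indicator T \<in> I"
proof -
  have c: "c \<in> K" "inverse c \<in> K"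
    using assms(3) by (auto simp: takes_value_def intro: K_closed)
  have "p * point_indicator T - (p - Const c) * point_indicator T \<in> I"
    using assms I_diff[OF I_mult[OF assms(2) point_indicator_closed[OF assms(1)]]]
    by (simp add: takes_value_def)
  then have "Const c * point_indicator T \<in> I"
    by (simp add: algebra_simps)
  then have "Const c * point_indicator T * Const (inverse c) \<in> I"
    by (rule I_mult) (intro Const_closed c)
  moreover have "Const c * Const (inverse c) = (1 :: 'v mpolynomial)"
    using assms(4) by (simp add: Const_def mult_single)
  ultimately show ?thesis
    by (metis mult.assoc mult.commute mult_1)
qed

text \<open>
  The indicators of the points of \<open>{0, 1}\<^sup>V\<close> sum to \<open>1\<close>, so membership in the ideal may be
  tested at one point at a time.
\<close>

lemma mem_ideal_if_vanishing:
  assumes "f \<in> carrier P"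
    and "\<And>T. \<lbrakk>T \<subseteq> Vs; point_indicator T \<notin> I\<rbrakk> \<Longrightarrow> takes_value T f 0"
  shows "f \<in> I"
proof -
  have "(1 :: 'v mpolynomial) = (\<Prod>v\<in>Vs. Var v + (1 - Var v))"
    by simp
  also have "\<dots> = (\<Sum>T\<in>Pow Vs. point_indicator T)"
    unfolding point_indicator_def by (rule prod_add[OF finite_Vs])
  finally have "f = (\<Sum>T\<in>Pow Vs. point_indicator T * f)"
    by (metis mult_1 sum_distrib_right)
  also have "\<dots> \<in> I"
  proof (rule I_sum)
    fix T assume "T \<in> Pow Vs"
    then show "point_indicator T * f \<in> I"
      using assms(2)[of T] I_mult[OF _ assms(1), of "point_indicator T"]
      by (cases "point_indicator T \<in> I") (auto simp: takes_value_def Const_def mult.commute)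
  qed
  finally show ?thesis .
qed

end

section \<open>The Vizing ideal\<close>

lemma finite_viz_vars: "\<lbrakk>finite VG; finite VH\<rbrakk> \<Longrightarrow> finite (viz_vars VG VH)"
  by (rule finite_subset[of _ "EG ` Pow VG \<union> EH ` Pow VH \<union> case_prod XV ` (VG \<times> VH)"])
    (auto simp: viz_vars_def)

text \<open>The product is 1 exactly when \<open>S\<close> is contained in \<open>T\<close>, so the
  sum counts the \<open>i\<close>-subsets of \<open>T\<close>. This evaluates
  \<open>sigma_poly\<close> at a 0/1 point.\<close>

lemma sum_prod_of_bool:
  assumes "finite V" and "T \<subseteq> V"
  shows "(\<Sum>S | S \<subseteq> V \<and> card S = i. \<Prod>h\<in>S. of_bool (h \<in> T) :: real) = real (card T choose i)"
proof -
  have fin: "finite S" if "S \<subseteq> V" for S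
    using assms(1) that finite_subset by auto
  have "(\<Prod>h\<in>S. of_bool (h \<in> T) :: real) = of_bool (S \<subseteq> T)" if "S \<subseteq> V" for S
    using fin[OF that] by (induction S rule: finite_induct) auto
  then have "(\<Sum>S | S \<subseteq> V \<and> card S = i. \<Prod>h\<in>S. of_bool (h \<in> T) :: real)
      = (\<Sum>S | S \<subseteq> V \<and> card S = i. of_bool (S \<subseteq> T))"
    by (intro sum.cong) auto
  also have "\<dots> = real (card ({S. S \<subseteq> V \<and> card S = i} \<inter> {S. S \<subseteq> T}))"
    by (rule sum_of_bool_eq) (rule finite_subset[of _ "Pow V"], use assms(1) in auto)
  also have "{S. S \<subseteq> V \<and> card S = i} \<inter> {S. S \<subseteq> T} = {S. S \<subseteq> T \<and> card S = i}"
    using assms(2) by auto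
  also have "real (card {S. S \<subseteq> T \<and> card S = i}) = real (card T choose i)"
    using n_subsets[of T i] fin assms by simp
  finally show ?thesis .
qed

text \<open>The generators only exclude dominating sets of size exactly \<open>k - 1\<close>. A
  smaller \<open>T\<close> can be enlarged to that size, and enlarging preserves domination.\<close>

lemma card_dominating_ge:
  assumes "finite V" and "T \<subseteq> V" and "k \<le> card V" and "k \<ge> 1"
    and no_dom: "\<And>S. \<lbrakk>S \<subseteq> V; card S + 1 = k\<rbrakk> \<Longrightarrow> \<exists>v\<in>V - S. \<forall>u\<in>S. \<not> E u v"
    and dom: "\<And>v. v \<in> V - T \<Longrightarrow> \<exists>u\<in>T. E u v"
  shows "k \<le> card T"
proof (rule ccontr)
  assume "\<not> k \<le> card T"
  then have "card T \<le> k - 1" "k - 1 \<le> card V"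
    using assms(3) by auto
  then obtain S where S: "T \<subseteq> S" "S \<subseteq> V" "card S = k - 1"
    using exists_subset_between[of T "k - 1" V] assms(1,2) by blast
  then obtain v where "v \<in> V - S" "\<forall>u\<in>S. \<not> E u v"
    using no_dom[of S] assms(4) by auto
  then show False
    using dom[of v] S(1) by blast
qed

lemma vizing_certificate:
  fixes VG DG :: "'g set" and VH DH :: "'h set"
  assumes K: "subfield K (ring_of_type_algebra :: real ring)" "sqrt 2 \<in> K" "sqrt 3 \<in> K"
    and fin: "finite VG" "finite VH"
    and DG: "DG = VG" "card VG \<ge> 1"
    and DH: "DH \<subseteq> VH" "card DH = card VH - 4" "card DH \<ge> 1"
  shows "viz_poly VG DG VH DH - (\<Sum>g\<in>VG. (s_poly VH g)\<^sup>2) \<in> viz_ideal K VG DG VH DH"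
  \<comment> \<open>Membership in the generated ideal becomes membership in every ideal
    \<open>I\<close> containing the generators.\<close>
  unfolding viz_ideal_def genideal_def
proof safe
  fix I assume I: "ideal I (viz_ring K VG VH)"
    and gens: "graph_generators VG DG eG \<union> graph_generators VH DH eH
                 \<union> product_generators VG VH \<subseteq> I"
  let ?Vs = "viz_vars VG VH"
  let ?f = "viz_poly VG DG VH DH - (\<Sum>g\<in>VG. (s_poly VH g)\<^sup>2)"
  interpret boolean_ideal K ?Vs I
  proof (rule boolean_ideal.intro)
    fix v assume "v \<in> ?Vs"
    then have "(Var v)\<^sup>2 - Var v \<in> graph_generators VG DG eG \<union> graph_generators VH DH eH
                 \<union> product_generators VG VH"
      unfolding viz_vars_def graph_generators_def product_generators_def by blast
    then show "(Var v)\<^sup>2 - Var v \<in> I"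
      using gens by blast
  qed (use K I fin finite_viz_vars in blast)+
  define val where "val T = (\<lambda>v. of_bool (v \<in> T) :: real)" for T :: "('g, 'h) viz_var set"
  have XV: "takes_value T (xv g h) (val T (XV g h))" if "T \<subseteq> ?Vs" "g \<in> VG" "h \<in> VH" for T g h
    unfolding val_def using that by (intro takes_value_Var) (auto simp: viz_vars_def)
  have EG: "takes_value T (eG g g') (val T (EG {g, g'}))"
    if "T \<subseteq> ?Vs" "g \<in> VG" "g' \<in> VG" "g \<noteq> g'" for T g g'
    unfolding val_def using that by (intro takes_value_Var) (auto simp: viz_vars_def)
  have EH: "takes_value T (eH h h') (val T (EH {h, h'}))"
    if "T \<subseteq> ?Vs" "h \<in> VH" "h' \<in> VH" "h \<noteq> h'" for T h h'
    unfolding val_def using that by (intro takes_value_Var) (auto simp: viz_vars_def)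
  have f: "takes_value T ?f
      (((\<Sum>g\<in>VG. \<Sum>h\<in>VH. val T (XV g h)) - real (card DG) * real (card DH))
        - (\<Sum>g\<in>VG. (\<Sum>i\<le>4. alpha (real (card VH)) i *
              (\<Sum>S | S \<subseteq> VH \<and> card S = i. \<Prod>h\<in>S. val T (XV g h)))\<^sup>2))"
    if T: "T \<subseteq> ?Vs" for T
    unfolding viz_poly_def s_poly_def sigma_poly_def
    by (intro takes_value_diff takes_value_sum takes_value_power takes_value_mult
        takes_value_prod takes_value_Const K_closed alpha_in_subfield[OF K] XV T) auto
  show "?f \<in> I"
  proof (rule mem_ideal_if_vanishing)
    \<comment> \<open>Membership in the carrier is part of \<open>takes_value\<close>, so any point
      serves; the origin is taken.\<close>
    show "?f \<in> carrier P"
      using f[of "{}"] by (simp add: takes_value_def)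
  next
    fix T assume T: "T \<subseteq> ?Vs" and pt: "point_indicator T \<notin> I"
    \<comment> \<open>A generator with a nonzero value at \<open>T\<close> would force the indicator
      of \<open>T\<close> into \<open>I\<close>.\<close>
    have vanish: "c = 0" if "p \<in> graph_generators VG DG eG \<union> graph_generators VH DH eH
                 \<union> product_generators VG VH" "takes_value T p c" for p c
      using point_indicator_in_ideal[OF T _ that(2)] that(1) gens pt by blast
    have eG_0: "val T (EG {u, v}) = 0" if uv: "u \<in> VG" "v \<in> VG" "u \<noteq> v" for u v
    proof -
      \<comment> \<open>Since \<open>DG = VG\<close>, this set has the size required by the third
        family of generators, and its complement is \<open>{v}\<close>: the product collapses to one
        sum of nonnegative edge values at \<open>v\<close>.\<close>
      let ?S = "VG - {v}"
      have "(\<Prod>w\<in>VG - ?S. \<Sum>u\<in>?S. val T (EG {u, w})) = 0"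
      proof (rule vanish)
        show "takes_value T (\<Prod>w\<in>VG - ?S. \<Sum>u\<in>?S. eG u w) (\<Prod>w\<in>VG - ?S. \<Sum>u\<in>?S. val T (EG {u, w}))"
          by (intro takes_value_prod takes_value_sum EG T) auto
        have "?S \<subseteq> VG" "card ?S + 1 = card DG"
          using DG fin uv by auto
        then show "(\<Prod>w\<in>VG - ?S. \<Sum>u\<in>?S. eG u w) \<in> graph_generators VG DG eG
            \<union> graph_generators VH DH eH \<union> product_generators VG VH"
          unfolding graph_generators_def by blast
      qed
      moreover have "VG - ?S = {v}"
        using uv by auto
      ultimately have "(\<Sum>u\<in>?S. val T (EG {u, v})) = 0"
        by simp
      then show ?thesis
        using uv fin by (subst (asm) sum_nonneg_eq_0_iff) (auto simp: val_def)
    qed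
    \<comment> \<open>A vanishing product has a vanishing factor, and a vanishing sum of 0/1 values
      has only zero terms; the vertex of that factor has no neighbour in \<open>S\<close>.\<close>
    have no_dom: "\<exists>v\<in>VH - S. \<forall>u\<in>S. \<not> EH {u, v} \<in> T"
      if S: "S \<subseteq> VH" "card S + 1 = card DH" for S
    proof -
      have finS: "finite S"
        using S(1) fin(2) by (rule finite_subset)
      have "(\<Prod>w\<in>VH - S. \<Sum>u\<in>S. val T (EH {u, w})) = 0"
      proof (rule vanish)
        show "takes_value T (\<Prod>w\<in>VH - S. \<Sum>u\<in>S. eH u w) (\<Prod>w\<in>VH - S. \<Sum>u\<in>S. val T (EH {u, w}))"
          using S by (intro takes_value_prod takes_value_sum EH T) auto
        show "(\<Prod>w\<in>VH - S. \<Sum>u\<in>S. eH u w) \<in> graph_generators VG DG eG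
            \<union> graph_generators VH DH eH \<union> product_generators VG VH"
          using S unfolding graph_generators_def by blast
      qed
      then obtain w where w: "w \<in> VH - S" "(\<Sum>u\<in>S. val T (EH {u, w})) = 0"
        using fin by auto
      then have "\<forall>u\<in>S. val T (EH {u, w}) = 0"
        using finS by (subst (asm) sum_nonneg_eq_0_iff) (auto simp: val_def)
      then show ?thesis
        using w(1) by (auto simp: val_def)
    qed
    \<comment> \<open>By \<open>eG_0\<close> the product over \<open>VG - {g}\<close> is 1, so a
      factor for some \<open>h'\<close> must vanish: domination happens inside the fibre of
      \<open>g\<close>.\<close>
    have dom: "\<exists>h'. h' \<in> VH \<and> h' \<noteq> h \<and> XV g h' \<in> T \<and> EH {h', h} \<in> T"
      if gh: "g \<in> VG" "h \<in> VH" "XV g h \<notin> T" for g h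
    proof -
      have "(1 - val T (XV g h)) * (\<Prod>g'\<in>VG - {g}. (1 - val T (EG {g, g'}) * val T (XV g' h)))
          * (\<Prod>h'\<in>VH - {h}. (1 - val T (EH {h, h'}) * val T (XV g h'))) = 0"
      proof (rule vanish)
        show "takes_value T ((1 - xv g h) * (\<Prod>g'\<in>VG - {g}. (1 - eG g g' * xv g' h))
            * (\<Prod>h'\<in>VH - {h}. (1 - eH h h' * xv g h')))
          ((1 - val T (XV g h)) * (\<Prod>g'\<in>VG - {g}. (1 - val T (EG {g, g'}) * val T (XV g' h)))
          * (\<Prod>h'\<in>VH - {h}. (1 - val T (EH {h, h'}) * val T (XV g h'))))"
          using gh by (intro takes_value_mult takes_value_diff takes_value_prod takes_value_1 XV EG EH T) auto
        show "(1 - xv g h) * (\<Prod>g'\<in>VG - {g}. (1 - eG g g' * xv g' h))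
            * (\<Prod>h'\<in>VH - {h}. (1 - eH h h' * xv g h')) \<in> graph_generators VG DG eG
            \<union> graph_generators VH DH eH \<union> product_generators VG VH"
          using gh unfolding product_generators_def by blast
      qed
      moreover have "(\<Prod>g'\<in>VG - {g}. (1 - val T (EG {g, g'}) * val T (XV g' h))) = 1"
        using eG_0 gh by (intro prod.neutral) auto
      moreover have "val T (XV g h) = 0"
        using gh by (simp add: val_def)
      ultimately have "(\<Prod>h'\<in>VH - {h}. (1 - val T (EH {h, h'}) * val T (XV g h'))) = 0"
        by simp
      then obtain h' where "h' \<in> VH - {h}" "val T (EH {h, h'}) * val T (XV g h') = 1"
        using fin by auto
      then show ?thesis
        by (cases "EH {h, h'} \<in> T"; cases "XV g h' \<in> T") (auto simp: val_def insert_commute)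
    qed
    define F where "F g = {h \<in> VH. XV g h \<in> T}" for g
    have F_sub: "F g \<subseteq> VH" for g
      by (auto simp: F_def)
    have cardF: "card VH - 4 \<le> card (F g)" "card (F g) \<le> card VH" if g: "g \<in> VG" for g
    proof -
      show "card VH - 4 \<le> card (F g)"
        unfolding DH(2)[symmetric]
      proof (rule card_dominating_ge[OF fin(2) F_sub, where E = "\<lambda>u v. EH {u, v} \<in> T"])
        show "\<exists>u\<in>F g. EH {u, v} \<in> T" if "v \<in> VH - F g" for v
          using dom[OF g, of v] that by (auto simp: F_def)
        show "card DH \<le> card VH" "card DH \<ge> 1"
          using DH by simp_all
      qed (fact no_dom)
      show "card (F g) \<le> card VH"
        using fin(2) F_sub by (rule card_mono)
    qed
    have val_F: "val T (XV g h) = of_bool (h \<in> F g)" if "h \<in> VH" for g h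
      using that by (simp add: val_def F_def)
    have sigma: "(\<Sum>S | S \<subseteq> VH \<and> card S = i. \<Prod>h\<in>S. val T (XV g h)) = real (card (F g) choose i)"
      for g i
    proof -
      have "(\<Sum>S | S \<subseteq> VH \<and> card S = i. \<Prod>h\<in>S. val T (XV g h))
          = (\<Sum>S | S \<subseteq> VH \<and> card S = i. \<Prod>h\<in>S. of_bool (h \<in> F g))"
        by (intro sum.cong prod.cong refl val_F) auto
      then show ?thesis
        using sum_prod_of_bool[OF fin(2) F_sub] by simp
    qed
    have lin: "(\<Sum>h\<in>VH. val T (XV g h)) = real (card (F g))" for g
    proof -
      have "VH \<inter> {h. h \<in> F g} = F g"
        using F_sub by auto
      then show ?thesis
        using fin(2) by (simp add: val_F sum_of_bool_eq)
    qed
    have sq: "(\<Sum>i\<le>4. alpha (real (card VH)) i * real (card (F g) choose i))\<^sup>2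
        = real (card (F g)) - real (card DH)" if "g \<in> VG" for g
      unfolding DH(2) using cardF[OF that] DH by (intro alpha_certificate_identity) auto
    have "((\<Sum>g\<in>VG. \<Sum>h\<in>VH. val T (XV g h)) - real (card DG) * real (card DH))
        - (\<Sum>g\<in>VG. (\<Sum>i\<le>4. alpha (real (card VH)) i *
              (\<Sum>S | S \<subseteq> VH \<and> card S = i. \<Prod>h\<in>S. val T (XV g h)))\<^sup>2) = 0"
      \<comment> \<open>By \<open>sq\<close> the squares sum to the total size of the fibres minus
        \<open>card VG * card DH\<close>, which is the value of \<open>viz_poly\<close> because
        \<open>DG = VG\<close>.\<close>
      unfolding sigma lin by (simp add: sq sum_subtractf DG)
    then show "takes_value T ?f 0"
      using f[OF T] by simp
  qed
qed

theorem theorem5p21: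
  fixes K :: "real set"
    and VG DG :: "'g set" and VH DH :: "'h set"
    and nG kG nH kH :: nat
  assumes "subfield K (ring_of_type_algebra :: real ring)"
    and "sqrt 2 \<in> K" and "sqrt 3 \<in> K"
    and "finite VG" and "card VG = nG" and "DG \<subseteq> VG" and "card DG = kG"
    and "finite VH" and "card VH = nH" and "DH \<subseteq> VH" and "card DH = kH"
    and "kG = nG" and "nG \<ge> 1"
    and "kH = nH - 4" and "kH \<ge> 1"
  shows "sos_certificate (viz_ring K VG VH) (viz_ideal K VG DG VH DH) 4
           VG (s_poly VH) (viz_poly VG DG VH DH)
       \<and> (\<forall>(G :: 'a pair_pre_digraph) (H :: 'b pair_pre_digraph).
            pair_graph G \<and> pair_graph H \<and>
            card (pverts G) = nG \<and> domination_number G = nG \<and>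
            card (pverts H) = nH \<and> domination_number H = nH - 4 \<longrightarrow>
            domination_number G * domination_number H
              \<le> domination_number (cartesian_graph_product G H))"
proof (intro conjI allI impI)
  have "DG = VG"
    using assms(4-7,12) by (intro card_subset_eq) simp_all
  then have "viz_poly VG DG VH DH - (\<Sum>g\<in>VG. (s_poly VH g)\<^sup>2) \<in> viz_ideal K VG DG VH DH"
    using assms by (intro vizing_certificate) simp_all
  then show "sos_certificate (viz_ring K VG VH) (viz_ideal K VG DG VH DH) 4
           VG (s_poly VH) (viz_poly VG DG VH DH)"
    unfolding sos_certificate_def
    by (intro conjI ballI s_poly_in_viz_ring total_degree_s_poly assms)
next
  fix G :: "'a pair_pre_digraph" and H :: "'b pair_pre_digraph"
  assume GH: "pair_graph G \<and> pair_graph H \<and>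
            card (pverts G) = nG \<and> domination_number G = nG \<and>
            card (pverts H) = nH \<and> domination_number H = nH - 4"
  then interpret G: pair_graph G by simp
  interpret H: pair_graph H using GH by simp
  have "parcs G = {}"
    using GH by (intro edgeless_if_domination_number_eq_card) auto
  then show "domination_number G * domination_number H
              \<le> domination_number (cartesian_graph_product G H)"
    using vizing_edgeless[OF G.pair_finite_verts H.pair_finite_verts] GH by simp
qed

end
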